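(* For every four different collinear points $V_1,P,Q,V_2$ in the plane, with $P,Q$ between $V_1$ and $V_2$: if there exists an analytic curve with equichordal points $P,Q$ and vertices $V_1,V_2$, then this curve is unique.
   Context: A plane curve $c$ is analytic if in a neighbourhood of each of its points it admits a local regular analytic parametrization. The curves considered are plane Jordan curves $c$ whose interior region is convex. A chord of $c$ is a segment whose endpoints belong to $c$. A point $P$ in the interior region of $c$ is an equichordal point of $c$ if all chords of $c$ passing through $P$ have the same length; that is, there is a constant $k_P$ such that $\|A-P\|+\|B-P\|=k_P$ for every chord of $c$ through $P$ with endpoints $A,B$. For a curve $c$ with two distinct equichordal points $P,Q$, the vertices of $c$ are the two points where the line through $P,Q$ meets $c$. *)

theory Defs
  imports "HOL-Analysis.Analysis"
begin

type_synonym plane = "real ^ 2"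

definition jordan_curve :: "'a::real_normed_vector set \<Rightarrow> bool" where
  "jordan_curve C \<longleftrightarrow>
     (\<exists>g. simple_path g \<and> pathfinish g = pathstart g \<and> path_image g = C)"

(* The condition on s ranges over a full neighbourhood of t, even when S is not open. *)
definition real_analytic_on :: "(real \<Rightarrow> 'a::real_normed_vector) \<Rightarrow> real set \<Rightarrow> bool" where
  "real_analytic_on f S \<longleftrightarrow>
     (\<forall>t\<in>S. \<exists>r>0. \<exists>a :: nat \<Rightarrow> 'a.
        \<forall>s. \<bar>s - t\<bar> < r \<longrightarrow> (\<lambda>n. (s - t) ^ n *\<^sub>R a n) sums f s)"

(* A curve is its point set; the regular analytic parametrization near p is a
   homeomorphism from an open interval onto a relatively open part of C. *)
definition analytic_curve :: "'a::real_normed_vector set \<Rightarrow> bool" where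
  "analytic_curve C \<longleftrightarrow>
     (\<forall>p\<in>C. \<exists>U a b \<gamma> h.
        open U \<and> p \<in> U \<and> a < b \<and>
        homeomorphism {a<..<b} (C \<inter> U) \<gamma> h \<and>
        real_analytic_on \<gamma> {a<..<b} \<and>
        (\<forall>t\<in>{a<..<b}. vector_derivative \<gamma> (at t) \<noteq> 0))"

definition equichordal_point :: "'a::real_normed_vector set \<Rightarrow> 'a \<Rightarrow> bool" where
  "equichordal_point C P \<longleftrightarrow>
     P \<in> inside C \<and>
     (\<exists>k. \<forall>A\<in>C. \<forall>B\<in>C. P \<in> closed_segment A B \<longrightarrow> norm (A - P) + norm (B - P) = k)"

definition vertices :: "'a::real_normed_vector set \<Rightarrow> 'a \<Rightarrow> 'a \<Rightarrow> 'a set" where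
  "vertices C P Q = C \<inter> affine hull {P, Q}"

definition analytic_equichordal_curve ::
    "plane set \<Rightarrow> plane \<Rightarrow> plane \<Rightarrow> plane \<Rightarrow> plane \<Rightarrow> bool" where
  "analytic_equichordal_curve C P Q V\<^sub>1 V\<^sub>2 \<longleftrightarrow>
     jordan_curve C \<and> convex (inside C) \<and> analytic_curve C \<and>
     equichordal_point C P \<and> equichordal_point C Q \<and>
     vertices C P Q = {V\<^sub>1, V\<^sub>2}"

end

theory Submission
  imports Defs
begin

text \<open>
  All chords through \<open>P\<close> or \<open>Q\<close> have length \<open>|V\<^sub>1 V\<^sub>2|\<close>.  Alternating between passing to the
  other end of the chord through \<open>P\<close> and through \<open>Q\<close> pushes every point of the curve towards the
  axis: the cotangent \<open>w\<close> of its direction angle, seen from the centre in use, grows by at least a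
  fixed amount per step.  Given two curves, follow a point of the first together with a point of the
  second on the same ray from the current centre, re-choosing the second point whenever the centre
  changes.  The passage along the chord preserves the difference vector of the two points, and
  convexity bounds the change of its axial component \<open>\<xi>\<close> caused by re-choosing by
  \<open>K |\<xi>| (1/w - 1/w')\<close>; hence \<open>|\<xi>| (1 - K/w)\<close> does not decrease.  But \<open>\<xi>\<close> tends to \<open>0\<close>, because
  both points tend to a common vertex.  So the curves agree at all points with \<open>w > K\<close>, and,
  running the iteration backwards, everywhere.
\<close>

section \<open>Jordan curves as frontiers of their interior regions\<close>

text \<open>The curve is a homeomorphic image of the unit sphere of the plane, and Jordan-Brouwer
  makes it the frontier of every component of its complement. Connectedness is what turns
  \<open>inside C\<close> into such a component; later it comes from convexity.\<close>

lemma frontier_inside_jordan_curve: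
  fixes C :: "'a::euclidean_space set"
  assumes "jordan_curve C" "DIM('a) = 2" "connected (inside C)" "inside C \<noteq> {}"
  shows "frontier (inside C) = C"
proof -
  obtain g where g: "simple_path g" "pathfinish g = pathstart g" "path_image g = C"
    using assms(1) by (auto simp: jordan_curve_def)
  have "C homeomorphic sphere (0::complex) 1"
    using homeomorphic_simple_path_image_circle[OF g(1,2), of 1 0] g(3) by simp
  also have "sphere (0::complex) 1 homeomorphic sphere (0::'a) 1"
    by (rule homeomorphic_spheres') (simp_all add: assms(2))
  finally have "C homeomorphic sphere (0::'a) 1" .
  moreover have "inside C \<in> components (- C)"
    by (simp add: inside_in_components assms)
  ultimately show ?thesis
    by (rule Jordan_Brouwer_frontier) (simp add: assms(2))
qed

section \<open>Chords of fixed length through a centre\<close>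

text \<open>For \<open>0 < norm (A - M) < k\<close> this is the other end of the chord of length
  \<open>k\<close> that starts at \<open>A\<close> and passes through \<open>M\<close>. The formula
  mentions no curve, so one map serves both curves.\<close>

definition antipode :: "real \<Rightarrow> 'a::real_normed_vector \<Rightarrow> 'a \<Rightarrow> 'a" where
  "antipode k M A = M - ((k - norm (A - M)) / norm (A - M)) *\<^sub>R (A - M)"

lemma antipode_antipode:
  assumes "A \<noteq> M" "norm (A - M) < k"
  shows "antipode k M (antipode k M A) = A"
proof -
  define n where "n = norm (A - M)"
  have n: "0 < n" "n < k" using assms by (auto simp: n_def)
  have B: "antipode k M A - M = (- ((k - n) / n)) *\<^sub>R (A - M)"
    by (simp add: antipode_def n_def)
  have "norm (antipode k M A - M) = k - n"
    unfolding B using n by (simp add: n_def[symmetric])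
  then have "antipode k M (antipode k M A) = M - (n / (k - n)) *\<^sub>R (- ((k - n) / n)) *\<^sub>R (A - M)"
    by (subst antipode_def) (simp add: B)
  also have "\<dots> = A"
    using n by simp
  finally show ?thesis .
qed

text \<open>Along a ray from the centre, passing to the other end of the chord is a translation.\<close>

lemma antipode_diff:
  assumes "A \<noteq> M" "0 < r" "A' - M = r *\<^sub>R (A - M)"
  shows "antipode k M A' - antipode k M A = A' - A"
proof -
  define n where "n = norm (A - M)"
  have n: "0 < n" using assms by (auto simp: n_def)
  have n': "norm (A' - M) = r * n" using assms by (simp add: n_def)
  have "antipode k M A' - antipode k M A
      = ((k - n) / n - (k - r * n) / (r * n) * r) *\<^sub>R (A - M)"
    unfolding antipode_def n' n_def[symmetric] unfolding assms(3) by (simp add: algebra_simps)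
  also have "(k - n) / n - (k - r * n) / (r * n) * r = r - 1"
    using n assms(2) by (simp add: field_simps)
  also have "(r - 1) *\<^sub>R (A - M) = (A' - M) - (A - M)"
    by (simp add: assms(3) algebra_simps)
  finally show ?thesis by simp
qed

text \<open>The ray from \<open>M\<close> away from \<open>A\<close> leaves the bounded set
  \<open>S\<close> at some frontier point. The chord condition forces the distance of that point
  from \<open>M\<close> to be \<open>k - norm (A - M)\<close>, so it is the antipode.\<close>

lemma antipode_mem_frontier:
  fixes S :: "'a::euclidean_space set"
  assumes "open S" "bounded S" "M \<in> S" "A \<in> frontier S"
    and chord: "\<And>A B. A \<in> frontier S \<Longrightarrow> B \<in> frontier S \<Longrightarrow> M \<in> closed_segment A B
      \<Longrightarrow> norm (A - M) + norm (B - M) = k"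
  shows "A \<noteq> M" "norm (A - M) < k" "antipode k M A \<in> frontier S"
proof -
  show ne: "A \<noteq> M"
    using assms by (auto simp: frontier_def interior_open)
  obtain d where d: "0 < d" "M + d *\<^sub>R (M - A) \<in> frontier S"
    using ray_to_frontier[OF assms(2), of M "M - A"] assms(1,3) ne by (auto simp: interior_open)
  have "M = (1 - 1 / (1 + d)) *\<^sub>R A + (1 / (1 + d)) *\<^sub>R (M + d *\<^sub>R (M - A))"
  proof -
    have "(1 - 1 / (1 + d)) *\<^sub>R A + (1 / (1 + d)) *\<^sub>R (M + d *\<^sub>R (M - A))
        = (1 / (1 + d) + d / (1 + d)) *\<^sub>R M + (1 - (1 / (1 + d) + d / (1 + d))) *\<^sub>R A"
      by (simp add: algebra_simps)
    also have "1 / (1 + d) + d / (1 + d) = 1"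
      using d(1) by (simp add: add_divide_distrib[symmetric])
    finally show ?thesis by simp
  qed
  then have "M \<in> closed_segment A (M + d *\<^sub>R (M - A))"
    using d(1) unfolding in_segment by (intro exI[of _ "1 / (1 + d)"]) auto
  from chord[OF assms(4) d(2) this] have *: "d * norm (A - M) = k - norm (A - M)"
    using d(1) by (simp add: norm_minus_commute)
  then show "norm (A - M) < k"
    using d(1) ne by (smt (verit) mult_pos_pos zero_less_norm_iff right_minus_eq)
  have "(k - norm (A - M)) / norm (A - M) = d"
    using * ne by (simp add: field_simps)
  then have "antipode k M A = M + d *\<^sub>R (M - A)"
    by (simp add: antipode_def algebra_simps)
  with d(2) show "antipode k M A \<in> frontier S" by simp
qed

section \<open>The monotone quantity\<close>

text \<open>With \<open>a = K / w\<close> and \<open>b = K / v\<close> the hypothesis gives a lower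
  bound for \<open>\<bar>\<eta>\<bar>\<close> with factor \<open>1 - a + b\<close>, and
  \<open>(1 - a + b) * (1 - b) = 1 - a + b * (a - b)\<close> is at least
  \<open>1 - a\<close>.\<close>

lemma potential_mono:
  fixes \<xi> \<eta> K v w :: real
  assumes "\<bar>\<xi> - \<eta>\<bar> \<le> K * \<bar>\<xi>\<bar> * (1 / w - 1 / v)" "0 < K" "K \<le> w" "w \<le> v"
  shows "\<bar>\<xi>\<bar> * (1 - K / w) \<le> \<bar>\<eta>\<bar> * (1 - K / v)"
proof -
  define a where "a = K / w"
  define b where "b = K / v"
  have ab: "0 \<le> b" "b \<le> a" "b \<le> 1"
    using assms(2-4) by (auto simp: a_def b_def intro!: divide_left_mono)
  have "K * \<bar>\<xi>\<bar> * (1 / w - 1 / v) = \<bar>\<xi>\<bar> * (a - b)"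
    by (simp add: a_def b_def algebra_simps)
  with assms(1) have "\<bar>\<xi>\<bar> - \<bar>\<eta>\<bar> \<le> \<bar>\<xi>\<bar> * (a - b)"
    by linarith
  then have \<eta>: "\<bar>\<xi>\<bar> * (1 - a + b) \<le> \<bar>\<eta>\<bar>"
    by (simp add: algebra_simps)
  have "(1 - a) \<le> (1 - a + b) * (1 - b)"
    using mult_nonneg_nonneg[of b "a - b"] ab by (simp add: algebra_simps)
  then have "\<bar>\<xi>\<bar> * (1 - a) \<le> \<bar>\<xi>\<bar> * ((1 - a + b) * (1 - b))"
    by (rule mult_left_mono) simp
  also have "\<dots> \<le> \<bar>\<eta>\<bar> * (1 - b)"
    using mult_right_mono[OF \<eta>, of "1 - b"] ab by (simp add: mult.assoc)
  finally show ?thesis by (simp add: a_def b_def)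
qed

section \<open>Linear coordinates and quantitative convexity\<close>

locale planar_coordinates =
  fixes X Y :: "'a::euclidean_space \<Rightarrow> real" and f :: 'a
  assumes linear_X: "linear X" and linear_Y: "linear Y"
    and X_f: "X f = 0" and Y_f: "Y f = 1"
    and coords_eqI: "\<And>A B. X A = X B \<Longrightarrow> Y A = Y B \<Longrightarrow> A = B"
begin

lemmas coords_simps =
  linear_add[OF linear_X] linear_diff[OF linear_X] linear_scale[OF linear_X]
  linear_add[OF linear_Y] linear_diff[OF linear_Y] linear_scale[OF linear_Y] X_f Y_f

lemma transversal_segment:
  assumes "open S" "M \<in> S"
  obtains \<rho> where "\<rho> > 0" "\<And>\<zeta>. \<bar>\<zeta>\<bar> < \<rho> \<Longrightarrow> M + \<zeta> *\<^sub>R f \<in> S"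
proof -
  obtain e where e: "e > 0" "ball M e \<subseteq> S"
    using assms open_contains_ball by blast
  have f: "norm f > 0"
    using Y_f linear_0[OF linear_Y] by force
  show ?thesis
  proof (rule that[of "e / norm f"])
    show "e / norm f > 0" using e f by simp
    fix \<zeta> assume "\<bar>\<zeta>\<bar> < e / norm f"
    then have "dist M (M + \<zeta> *\<^sub>R f) < e"
      using f by (simp add: dist_norm field_simps)
    then show "M + \<zeta> *\<^sub>R f \<in> S" using e by auto
  qed
qed

text \<open>The determinant on the right, divided by \<open>X A - X B\<close>, is up to sign the
  height at which the line \<open>A B\<close> crosses the transversal through \<open>M\<close> in
  direction \<open>f\<close>. A crossing at height below \<open>\<rho>\<close> would be an interior
  point of \<open>S\<close>, and convexity would then make one of \<open>A\<close>, \<open>B\<close>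
  interior as well.\<close>

lemma frontier_cone:
  assumes "open S" "convex S" and seg: "\<And>\<zeta>. \<bar>\<zeta>\<bar> < \<rho> \<Longrightarrow> M + \<zeta> *\<^sub>R f \<in> S"
    and "A \<in> frontier S" "B \<in> frontier S" "(X A - X M) * (X B - X M) > 0"
  shows "\<rho> * \<bar>X A - X B\<bar> \<le> \<bar>(X A - X M) * (Y B - Y M) - (X B - X M) * (Y A - Y M)\<bar>"
proof -
  \<comment> \<open>Here \<open>B\<close> is the point nearer to the transversal, so it lies between
    \<open>A\<close> and the crossing point \<open>M + \<zeta> *\<^sub>R f\<close>;
    \<open>\<tau>\<close> is the fraction of the way from \<open>A\<close>.\<close>
  have main: "\<rho> * \<bar>X A - X B\<bar> \<le> \<bar>(X A - X M) * (Y B - Y M) - (X B - X M) * (Y A - Y M)\<bar>"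
    if AB: "A \<in> frontier S" "B \<in> frontier S" "(X A - X M) * (X B - X M) > 0"
      and le: "\<bar>X B - X M\<bar> \<le> \<bar>X A - X M\<bar>" for A B
  proof (rule ccontr)
    define a where "a = X A - X M"
    define b where "b = X B - X M"
    define \<tau> where "\<tau> = (a - b) / a"
    define \<zeta> where "\<zeta> = (a * (Y B - Y M) - b * (Y A - Y M)) / (a - b)"
    assume "\<not> ?thesis"
    then have neg: "\<bar>a * (Y B - Y M) - b * (Y A - Y M)\<bar> < \<rho> * \<bar>a - b\<bar>"
      by (simp add: a_def b_def)
    then have ne: "a \<noteq> b" by auto
    have a: "a \<noteq> 0" using AB(3) by (auto simp: a_def)
    have \<tau>: "0 < \<tau>" "\<tau> \<le> 1"
      using AB(3) le ne unfolding \<tau>_def a_def[symmetric] b_def[symmetric]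
      by (auto simp: zero_less_mult_iff zero_less_divide_iff divide_le_eq)
    have "\<bar>\<zeta>\<bar> < \<rho>"
      using neg ne unfolding \<zeta>_def by (simp add: divide_less_eq)
    from seg[OF this] have "M + \<zeta> *\<^sub>R f \<in> interior S"
      using assms(1) by (simp add: interior_open)
    moreover have "A \<in> closure S"
      using AB(1) by (simp add: frontier_def)
    ultimately have "A - \<tau> *\<^sub>R (A - (M + \<zeta> *\<^sub>R f)) \<in> interior S"
      using mem_interior_closure_convex_shrink[OF assms(2)] \<tau> by blast
    moreover have "B = A - \<tau> *\<^sub>R (A - (M + \<zeta> *\<^sub>R f))"
    proof (rule coords_eqI)
      have "\<tau> * a = a - b" using a by (simp add: \<tau>_def)
      then show "X B = X (A - \<tau> *\<^sub>R (A - (M + \<zeta> *\<^sub>R f)))"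
        by (simp add: coords_simps a_def b_def)
      have "\<tau> * (Y A - Y M - \<zeta>) = Y A - Y B"
        using a ne unfolding \<tau>_def \<zeta>_def by (simp add: field_simps)
      then show "Y B = Y (A - \<tau> *\<^sub>R (A - (M + \<zeta> *\<^sub>R f)))"
        by (simp add: coords_simps algebra_simps)
    qed
    ultimately show False
      using AB(2) by (simp add: frontier_def)
  qed
  show ?thesis
  proof (cases "\<bar>X B - X M\<bar> \<le> \<bar>X A - X M\<bar>")
    case True
    then show ?thesis using main assms(4-6) by blast
  next
    case False
    then show ?thesis using main[of B A] assms(4-6) by (simp add: abs_minus_commute mult.commute)
  qed
qed

lemma affine_hull_iff:
  assumes "Y P = Y Q" "X P \<noteq> X Q"
  shows "A \<in> affine hull {P, Q} \<longleftrightarrow> Y A = Y P"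
proof
  assume "A \<in> affine hull {P, Q}"
  then obtain u v where "A = u *\<^sub>R P + v *\<^sub>R Q" "u + v = 1"
    by (auto simp: affine_hull_2)
  then show "Y A = Y P"
    using assms by (simp add: coords_simps distrib_right[symmetric])
next
  assume YA: "Y A = Y P"
  define t where "t = (X A - X P) / (X Q - X P)"
  have "A = (1 - t) *\<^sub>R P + t *\<^sub>R Q"
  proof (rule coords_eqI)
    have "t * (X Q - X P) = X A - X P" using assms by (simp add: t_def)
    then show "X A = X ((1 - t) *\<^sub>R P + t *\<^sub>R Q)"
      by (simp add: coords_simps algebra_simps)
    show "Y A = Y ((1 - t) *\<^sub>R P + t *\<^sub>R Q)"
      using YA assms by (simp add: coords_simps algebra_simps)
  qed
  then show "A \<in> affine hull {P, Q}"
    unfolding affine_hull_2 by (intro CollectI exI[of _ "1 - t"] exI[of _ t]) simp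
qed

end

section \<open>Two regions with common centres, vertices and chord length\<close>

text \<open>\<open>S\<close> and \<open>T\<close> are to be the interior regions of the two curves.
  The axis condition singles out \<open>S\<close> because the aim is a single inclusion of
  frontiers; the reverse one comes from exchanging the curves.\<close>

locale equichordal_pair = planar_coordinates X Y f
  for X Y :: "'a::euclidean_space \<Rightarrow> real" and f :: 'a +
  fixes S T :: "'a set" and P Q V W :: 'a and k :: real
  assumes open_S: "open S" and convex_S: "convex S" and bounded_S: "bounded S"
    and open_T: "open T" and convex_T: "convex T" and bounded_T: "bounded T"
    and axis: "Y P = Y Q" "X P \<noteq> X Q"
    and center_mem: "\<And>M. M \<in> {P, Q} \<Longrightarrow> M \<in> S \<inter> T"
    and chord_S: "\<And>M A B. M \<in> {P, Q} \<Longrightarrow> A \<in> frontier S \<Longrightarrow> B \<in> frontier S \<Longrightarrow>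
      M \<in> closed_segment A B \<Longrightarrow> norm (A - M) + norm (B - M) = k"
    and chord_T: "\<And>M A B. M \<in> {P, Q} \<Longrightarrow> A \<in> frontier T \<Longrightarrow> B \<in> frontier T \<Longrightarrow>
      M \<in> closed_segment A B \<Longrightarrow> norm (A - M) + norm (B - M) = k"
    and vertices_mem: "{V, W} \<subseteq> frontier S \<inter> frontier T"
    and vertices_axis: "Y V = Y P" "Y W = Y P"
    and vertices_sep: "\<And>M. M \<in> {P, Q} \<Longrightarrow> (X V - X M) * (X W - X M) < 0"
    and axis_S: "\<And>A. A \<in> frontier S \<Longrightarrow> Y A = Y P \<Longrightarrow> A \<in> {V, W}"
begin

definition extent_bound :: "real \<Rightarrow> bool" where
  "extent_bound L \<longleftrightarrow> (\<forall>M\<in>{P, Q}. \<forall>A\<in>frontier S \<union> frontier T.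
     \<bar>X A - X M\<bar> \<le> L \<and> \<bar>Y A - Y M\<bar> \<le> L)"

lemma extent_boundD:
  assumes "extent_bound L" "M \<in> {P, Q}" "A \<in> frontier S \<union> frontier T"
  shows "\<bar>X A - X M\<bar> \<le> L \<and> \<bar>Y A - Y M\<bar> \<le> L"
  using assms unfolding extent_bound_def by blast

text \<open>The conclusion of \<open>frontier_cone\<close> with one \<open>\<rho>\<close> for both
  centres and both regions, so that the constants of the iteration do not depend on the
  step.\<close>

definition cone_width :: "real \<Rightarrow> bool" where
  "cone_width \<rho> \<longleftrightarrow> \<rho> > 0 \<and>
     (\<forall>M\<in>{P, Q}. \<forall>C\<in>{S, T}. \<forall>A\<in>frontier C. \<forall>B\<in>frontier C. (X A - X M) * (X B - X M) > 0 \<longrightarrow>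
       \<rho> * \<bar>X A - X B\<bar> \<le> \<bar>(X A - X M) * (Y B - Y M) - (X B - X M) * (Y A - Y M)\<bar>)"

lemma cone_widthD:
  assumes "cone_width \<rho>"
  shows "\<rho> > 0"
    and "\<lbrakk>M \<in> {P, Q}; C = S \<or> C = T; A \<in> frontier C; B \<in> frontier C;
      (X A - X M) * (X B - X M) > 0\<rbrakk> \<Longrightarrow>
      \<rho> * \<bar>X A - X B\<bar> \<le> \<bar>(X A - X M) * (Y B - Y M) - (X B - X M) * (Y A - Y M)\<bar>"
  using assms unfolding cone_width_def by blast+

lemma uniform_bound:
  obtains L where "L > 0" "extent_bound L"
proof -
  let ?F = "{P, Q} \<union> (frontier S \<union> frontier T)"
  have "bounded ?F"
    using bounded_S bounded_T
    by (auto simp: frontier_def intro: bounded_subset[OF bounded_closure])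
  then have "bounded (X ` ?F)" "bounded (Y ` ?F)"
    using linear_X linear_Y by (auto intro: bounded_linear_image simp: linear_conv_bounded_linear)
  then obtain a c where "\<forall>x\<in>X ` ?F. \<bar>x\<bar> \<le> a" "\<forall>y\<in>Y ` ?F. \<bar>y\<bar> \<le> c"
    unfolding bounded_iff real_norm_def by blast
  then have a: "\<bar>X A\<bar> \<le> a" and c: "\<bar>Y A\<bar> \<le> c" if "A \<in> ?F" for A
    using that by blast+
  show ?thesis
  proof (rule that[of "1 + 2 * a + 2 * c"])
    have ac: "0 \<le> a" "0 \<le> c" using a[of P] c[of P] by auto
    then show "0 < 1 + 2 * a + 2 * c" by linarith
    show "extent_bound (1 + 2 * a + 2 * c)"
      unfolding extent_bound_def
    proof (intro ballI)
      fix M A assume "M \<in> {P, Q}" "A \<in> frontier S \<union> frontier T"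
      then have "\<bar>X A\<bar> \<le> a" "\<bar>Y A\<bar> \<le> c" "\<bar>X M\<bar> \<le> a" "\<bar>Y M\<bar> \<le> c" by (blast intro: a c)+
      then show "\<bar>X A - X M\<bar> \<le> 1 + 2 * a + 2 * c \<and> \<bar>Y A - Y M\<bar> \<le> 1 + 2 * a + 2 * c"
        using ac by linarith
    qed
  qed
qed

lemma uniform_cone:
  obtains \<rho> where "cone_width \<rho>"
proof -
  have o: "open (S \<inter> T)" using open_S open_T by blast
  obtain \<rho>1 where 1: "\<rho>1 > 0" "\<And>\<zeta>. \<bar>\<zeta>\<bar> < \<rho>1 \<Longrightarrow> P + \<zeta> *\<^sub>R f \<in> S \<inter> T"
    using transversal_segment[OF o] center_mem[of P] by blast
  obtain \<rho>2 where 2: "\<rho>2 > 0" "\<And>\<zeta>. \<bar>\<zeta>\<bar> < \<rho>2 \<Longrightarrow> Q + \<zeta> *\<^sub>R f \<in> S \<inter> T"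
    using transversal_segment[OF o] center_mem[of Q] by blast
  show ?thesis
  proof (rule that[of "min \<rho>1 \<rho>2"])
    have "M + \<zeta> *\<^sub>R f \<in> C" if "M \<in> {P, Q}" "C \<in> {S, T}" "\<bar>\<zeta>\<bar> < min \<rho>1 \<rho>2" for M C \<zeta>
      using that 1(2) 2(2) by auto
    then show "cone_width (min \<rho>1 \<rho>2)"
      unfolding cone_width_def using 1(1) 2(1) open_S open_T convex_S convex_T
      by (intro conjI ballI impI frontier_cone) auto
  qed
qed

lemma ray_meets_T:
  assumes "M \<in> {P, Q}" "A \<noteq> M"
  obtains r where "r > 0" "M + r *\<^sub>R (A - M) \<in> frontier T"
  using ray_to_frontier[OF bounded_T, of M "A - M"] center_mem[OF assms(1)] open_T assms(2)
  by (auto simp: interior_open)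

lemma antipode_S:
  assumes "M \<in> {P, Q}" "A \<in> frontier S"
  shows "A \<noteq> M" "norm (A - M) < k" "antipode k M A \<in> frontier S"
proof -
  have "M \<in> S" using center_mem[OF assms(1)] by simp
  note mem = antipode_mem_frontier[OF open_S bounded_S this assms(2)]
  show "A \<noteq> M" by (rule mem(1)) (rule chord_S[OF assms(1)])
  show "norm (A - M) < k" by (rule mem(2)) (rule chord_S[OF assms(1)])
  show "antipode k M A \<in> frontier S" by (rule mem(3)) (rule chord_S[OF assms(1)])
qed

lemma antipode_T:
  assumes "M \<in> {P, Q}" "A \<in> frontier T"
  shows "A \<noteq> M" "norm (A - M) < k" "antipode k M A \<in> frontier T"
proof -
  have "M \<in> T" using center_mem[OF assms(1)] by simp
  note mem = antipode_mem_frontier[OF open_T bounded_T this assms(2)]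
  show "A \<noteq> M" by (rule mem(1)) (rule chord_T[OF assms(1)])
  show "norm (A - M) < k" by (rule mem(2)) (rule chord_T[OF assms(1)])
  show "antipode k M A \<in> frontier T" by (rule mem(3)) (rule chord_T[OF assms(1)])
qed

section \<open>One step: along a chord, then to the other centre\<close>

text \<open>Seen from \<open>M\<close>, the cotangent is the same at \<open>A\<close> and
  \<open>B\<close>, since the chord is straight. Moving the centre to \<open>N\<close> adds
  \<open>(X M - X N) / (Y B - Y N)\<close>, which is positive by the side condition and bounded
  below because the height is at most \<open>L\<close>. Both factors in \<open>side\<close> change
  sign, so the condition reproduces itself with the centres exchanged.\<close>

lemma cot_step:
  assumes L: "\<And>M A. M \<in> {P, Q} \<Longrightarrow> A \<in> frontier S \<Longrightarrow> \<bar>Y A - Y M\<bar> \<le> L"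
    and MN: "(M, N) \<in> {(P, Q), (Q, P)}" and A: "A \<in> frontier S"
    and w: "X A - X M = w * (Y A - Y M)" and side: "(X N - X M) * (Y A - Y M) > 0"
    and B: "B = antipode k M A"
  obtains v where "X B - X N = v * (Y B - Y N)" "(X M - X N) * (Y B - Y N) > 0"
    "v \<ge> w + \<bar>X P - X Q\<bar> / L" "X B - X M = w * (Y B - Y M)"
proof -
  have M: "M \<in> {P, Q}" and NM: "Y N = Y M" and dist: "\<bar>X M - X N\<bar> = \<bar>X P - X Q\<bar>"
    using MN axis by auto
  define t where "t = (k - norm (A - M)) / norm (A - M)"
  define e where "e = Y B - Y M"
  have t: "t > 0" using antipode_S[OF M A] by (simp add: t_def)
  have "B = M - t *\<^sub>R (A - M)" by (simp add: B antipode_def t_def)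
  then have XB: "X B = X M - t * (X A - X M)" and YB: "Y B = Y M - t * (Y A - Y M)"
    by (simp_all add: coords_simps)
  have e: "e = - t * (Y A - Y M)" using YB by (simp add: e_def)
  have XBM: "X B - X M = w * e" using XB unfolding w e by simp
  have "(X M - X N) * e = t * ((X N - X M) * (Y A - Y M))"
    by (simp add: e algebra_simps)
  then have pos: "(X M - X N) * e > 0" using t side by simp
  then have e0: "e \<noteq> 0" by auto
  have "\<bar>e\<bar> \<le> L" using L[OF M antipode_S(3)[OF M A]] by (simp add: e_def B)
  then have "\<bar>X P - X Q\<bar> / L \<le> \<bar>X M - X N\<bar> / \<bar>e\<bar>"
    using e0 by (intro frac_le) (auto simp: dist)
  also have "\<dots> = \<bar>(X M - X N) / e\<bar>"
    by simp
  also have "\<dots> = (X M - X N) / e"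
    using pos by (intro abs_of_pos) (simp add: zero_less_mult_iff zero_less_divide_iff)
  finally have *: "\<bar>X P - X Q\<bar> / L \<le> (X M - X N) / e" .
  show ?thesis
  proof (rule that[of "w + (X M - X N) / e"])
    show "X B - X N = (w + (X M - X N) / e) * (Y B - Y N)"
      using XBM e0 by (simp add: NM e_def[symmetric] distrib_right)
  qed (use * XBM pos in \<open>auto simp: NM e_def\<close>)
qed

text \<open>A ray from \<open>M\<close>, meeting the two curves in \<open>A\<close> and \<open>A'\<close>; \<open>w\<close> is the cotangent of its angle
  with the axis.  The ray points to the side of \<open>M\<close> on which the other centre \<open>N\<close> lies.\<close>

definition ray_pair :: "'a \<Rightarrow> 'a \<Rightarrow> 'a \<Rightarrow> 'a \<Rightarrow> real \<Rightarrow> bool" where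
  "ray_pair M N A A' w \<longleftrightarrow>
     (M, N) \<in> {(P, Q), (Q, P)} \<and> A \<in> frontier S \<and> A' \<in> frontier T \<and>
     (\<exists>r>0. A' - M = r *\<^sub>R (A - M)) \<and> w > 0 \<and>
     X A - X M = w * (Y A - Y M) \<and> (X N - X M) * (Y A - Y M) > 0"

text \<open>The chords through \<open>M\<close> lead to \<open>B\<close> and \<open>C\<close> with
  \<open>C - B = A' - A\<close>, but \<open>C\<close> need not lie on the ray from \<open>N\<close>
  through \<open>B\<close>. The point \<open>D\<close> of \<open>frontier T\<close> on that ray
  replaces it, and the cone estimate for \<open>C\<close> and \<open>D\<close> seen from
  \<open>N\<close> controls the error.\<close>

lemma ray_pair_step:
  assumes L: "extent_bound L" and \<rho>: "cone_width \<rho>"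
    and pair: "ray_pair M N A A' w"
  obtains B B' v where "ray_pair N M B B' v" "v \<ge> w + \<bar>X P - X Q\<bar> / L"
    "\<rho> * \<bar>(X A' - X A) - (X B' - X B)\<bar> \<le> L * \<bar>X A' - X A\<bar> * (1 / w - 1 / v)"
proof -
  note L = extent_boundD[OF L] and \<rho> = cone_widthD[OF \<rho>]
  from pair obtain r where MN: "(M, N) \<in> {(P, Q), (Q, P)}"
    and A: "A \<in> frontier S" and A': "A' \<in> frontier T"
    and r: "r > 0" "A' - M = r *\<^sub>R (A - M)" and w: "w > 0" "X A - X M = w * (Y A - Y M)"
    and side: "(X N - X M) * (Y A - Y M) > 0"
    unfolding ray_pair_def by blast
  have M: "M \<in> {P, Q}" and N: "N \<in> {P, Q}" and NM: "Y N = Y M" and sym: "(N, M) \<in> {(P, Q), (Q, P)}"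
    using MN axis by auto
  define B where "B = antipode k M A"
  define C where "C = antipode k M A'"
  obtain v where v: "X B - X N = v * (Y B - Y N)" "(X M - X N) * (Y B - Y N) > 0"
    "v \<ge> w + \<bar>X P - X Q\<bar> / L" "X B - X M = w * (Y B - Y M)"
    by (rule cot_step[OF _ MN A w(2) side B_def, of L]) (use L in auto)
  have BS: "B \<in> frontier S" using antipode_S(3)[OF M A] by (simp add: B_def)
  have CT: "C \<in> frontier T" using antipode_T(3)[OF M A'] by (simp add: C_def)
  have "L \<ge> 0" using L[OF M, of A] A by force
  then have wv: "w \<le> v" "v > 0"
    using v(3) w(1) by (smt (verit) divide_nonneg_nonneg abs_ge_zero)+
  obtain s where s: "s > 0" "N + s *\<^sub>R (B - N) \<in> frontier T"
    using ray_meets_T[OF N antipode_S(1)[OF N BS]] by blast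
  define D where "D = N + s *\<^sub>R (B - N)"
  have DT: "D \<in> frontier T" using s by (simp add: D_def)
  define e where "e = Y B - Y N"
  define \<xi> where "\<xi> = X A' - X A"
  have XD: "X D - X N = s * (v * e)" and YD: "Y D - Y N = s * e"
    using v(1) by (simp_all add: D_def e_def coords_simps)
  have CB: "C - B = A' - A"
    unfolding B_def C_def by (rule antipode_diff[OF antipode_S(1)[OF M A] r])
  then have "X (C - B) = X (A' - A)" "Y (C - B) = Y (A' - A)" by simp_all
  then have XC: "X C - X B = \<xi>" and YC: "Y C - Y B = Y A' - Y A"
    by (simp_all add: coords_simps \<xi>_def)
  have "X (A' - M) = r * (X A - X M)" "Y (A' - M) = r * (Y A - Y M)"
    unfolding r(2) by (simp_all add: coords_simps)
  then have "X A' - X M = w * (Y A' - Y M)"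
    using w(2) by (simp add: coords_simps)
  then have "\<xi> = w * (Y A' - Y A)"
    using w(2) by (simp add: \<xi>_def algebra_simps)
  then have YC': "Y C - Y N = e + \<xi> / w"
    using YC w(1) by (simp add: e_def)
  have XC': "X C - X N = v * e + \<xi>"
    using XC v(1) by (simp add: e_def)
  \<comment> \<open>Both factors have the sign of \<open>e\<close>: the first is
    \<open>s * v * e\<close>, and \<open>X C - X N\<close> is the sum of \<open>X C - X M\<close>
    and \<open>X M - X N\<close>, each of that sign.\<close>
  have same: "(X D - X N) * (X C - X N) > 0"
  proof -
    have n: "norm (A - M) > 0" "norm (A' - M) > 0" "norm (A - M) < k" "norm (A' - M) < k"
      using antipode_S[OF M A] antipode_T[OF M A'] by auto
    define t where "t = (k - norm (A - M)) / norm (A - M)"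
    define t' where "t' = (k - norm (A' - M)) / norm (A' - M)"
    have t: "t > 0" "t' > 0" using n by (auto simp: t_def t'_def)
    have "C = M - (t' * r) *\<^sub>R (A - M)"
      by (simp add: C_def antipode_def t'_def r(2))
    then have "X C = X M - t' * r * (X A - X M)" by (simp add: coords_simps)
    then have c: "X C - X N = - (t' * r * w) * (Y A - Y M) + (X M - X N)"
      using w(2) by (simp add: algebra_simps)
    have "B = M - t *\<^sub>R (A - M)" by (simp add: B_def antipode_def t_def)
    then have "Y B = Y M - t * (Y A - Y M)" by (simp add: coords_simps)
    then have e: "e = - t * (Y A - Y M)" by (simp add: e_def NM)
    have "(X C - X N) * e = t' * r * w * t * (Y A - Y M)\<^sup>2 + (X M - X N) * e"
      unfolding c by (simp add: e power2_eq_square algebra_simps)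
    moreover have "(X M - X N) * e > 0" using v(2) by (simp add: e_def)
    moreover have "t' * r * w * t * (Y A - Y M)\<^sup>2 \<ge> 0" using t r w by simp
    ultimately have "(X C - X N) * e > 0" by linarith
    then have "s * v * ((X C - X N) * e) > 0" using s(1) wv(2) by simp
    then show ?thesis unfolding XD by (simp add: mult_ac)
  qed
  have "\<rho> * \<bar>X D - X C\<bar> \<le> \<bar>(X D - X N) * (Y C - Y N) - (X C - X N) * (Y D - Y N)\<bar>"
    by (rule \<rho>(2)[OF N _ DT CT same]) simp
  \<comment> \<open>\<open>C - B\<close> has coordinates \<open>\<xi>\<close> and
    \<open>\<xi> / w\<close>, being parallel to the ray from \<open>M\<close>, while
    \<open>D\<close> has cotangent \<open>v\<close> from \<open>N\<close>. The terms without
    \<open>\<xi>\<close> cancel.\<close>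
  also have "(X D - X N) * (Y C - Y N) - (X C - X N) * (Y D - Y N)
      = (X D - X N) * \<xi> * (1 / w - 1 / v)"
    unfolding XC' YC' XD YD using w(1) wv(2) by (simp add: field_simps)
  also have "\<bar>\<dots>\<bar> = \<bar>X D - X N\<bar> * (\<bar>\<xi>\<bar> * (1 / w - 1 / v))"
    using w(1) wv by (simp add: abs_mult frac_le)
  also have "\<dots> \<le> L * (\<bar>\<xi>\<bar> * (1 / w - 1 / v))"
    by (rule mult_right_mono) (use L[OF N, of D] DT w(1) wv in \<open>auto simp: frac_le\<close>)
  finally have "\<rho> * \<bar>X D - X C\<bar> \<le> L * \<bar>\<xi>\<bar> * (1 / w - 1 / v)"
    by (simp add: mult.assoc)
  moreover have "\<bar>X D - X C\<bar> = \<bar>\<xi> - (X D - X B)\<bar>" using XC by linarith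
  moreover have "ray_pair N M B D v"
    unfolding ray_pair_def using sym BS DT s(1) wv(2) v(1,2) by (auto simp: D_def)
  ultimately show ?thesis
    using that[of B D v] v(3) by (simp add: \<xi>_def)
qed

text \<open>Both points are close to the vertex \<open>U\<close> on their side of \<open>M\<close>.
  As \<open>U\<close> lies on the axis, the determinant in the cone estimate reduces to a product
  with the height of the point, which is at most \<open>L / w\<close>.\<close>

lemma ray_pair_bound:
  assumes L: "extent_bound L" and \<rho>: "cone_width \<rho>"
    and pair: "ray_pair M N A A' w"
  shows "\<bar>X A' - X A\<bar> \<le> 2 * L\<^sup>2 / \<rho> / w"
proof -
  note L = extent_boundD[OF L] and \<rho> = cone_widthD[OF \<rho>]
  from pair obtain r where MN: "(M, N) \<in> {(P, Q), (Q, P)}"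
    and A: "A \<in> frontier S" and A': "A' \<in> frontier T"
    and r: "r > 0" "A' - M = r *\<^sub>R (A - M)" and w: "w > 0" "X A - X M = w * (Y A - Y M)"
    and side: "(X N - X M) * (Y A - Y M) > 0"
    unfolding ray_pair_def by blast
  have M: "M \<in> {P, Q}" and NM: "Y N = Y M" "Y M = Y P" "X N \<noteq> X M"
    using MN axis by auto
  \<comment> \<open>The vertices lie on opposite sides of \<open>M\<close>, so one of them is on the
    side of the other centre.\<close>
  obtain U where U: "U \<in> frontier S" "U \<in> frontier T" "Y U = Y M" "(X U - X M) * (X N - X M) > 0"
  proof (cases "(X V - X M) * (X N - X M) > 0")
    case True
    then show ?thesis using that[of V] vertices_mem vertices_axis NM by auto
  next
    case False
    then have "(X W - X M) * (X N - X M) > 0"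
      using vertices_sep[OF M] NM(3) by (auto simp: zero_less_mult_iff mult_less_0_iff)
    then show ?thesis using that[of W] vertices_mem vertices_axis NM by auto
  qed
  have *: "\<bar>X Z - X U\<bar> \<le> L\<^sup>2 / \<rho> / w"
    if Z: "Z \<in> frontier C" "C = S \<or> C = T" "X Z - X M = w * (Y Z - Y M)" "(X N - X M) * (Y Z - Y M) > 0" for Z C
  proof -
    have UC: "U \<in> frontier C" "U \<in> frontier S \<union> frontier T" "Z \<in> frontier S \<union> frontier T"
      using U Z by auto
    have "(X Z - X M) * (X U - X M) > 0"
      using Z(4) U(4) w(1) unfolding Z(3) by (auto simp: zero_less_mult_iff mult_less_0_iff)
    from \<rho>(2)[OF M Z(2,1) UC(1) this]
    have "\<rho> * \<bar>X Z - X U\<bar> \<le> \<bar>X U - X M\<bar> * \<bar>Y Z - Y M\<bar>"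
      by (simp add: U(3) abs_mult)
    also have "\<bar>Y Z - Y M\<bar> = \<bar>X Z - X M\<bar> / w"
      using Z(3) w(1) by (simp add: abs_mult)
    also have "\<bar>X U - X M\<bar> * \<dots> \<le> L * (L / w)"
      using L[OF M UC(2)] L[OF M UC(3)] w(1) by (intro mult_mono divide_right_mono) auto
    finally show ?thesis
      using \<rho>(1) w(1) by (simp add: field_simps power2_eq_square)
  qed
  have "X (A' - M) = r * (X A - X M)" "Y (A' - M) = r * (Y A - Y M)"
    unfolding r(2) by (simp_all add: coords_simps)
  then have c: "X A' - X M = r * (X A - X M)" "Y A' - Y M = r * (Y A - Y M)"
    by (simp_all add: coords_simps)
  have "(X N - X M) * (Y A' - Y M) > 0"
    using side r(1) unfolding c by (auto simp: zero_less_mult_iff mult_less_0_iff)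
  then have "\<bar>X A' - X U\<bar> \<le> L\<^sup>2 / \<rho> / w"
    by (intro *[OF A']) (simp_all add: c w(2))
  moreover have "\<bar>X A - X U\<bar> \<le> L\<^sup>2 / \<rho> / w"
    using *[OF A _ w(2) side] by simp
  moreover have "2 * L\<^sup>2 / \<rho> / w = L\<^sup>2 / \<rho> / w + L\<^sup>2 / \<rho> / w"
    by (simp add: field_simps)
  ultimately show ?thesis by linarith
qed

section \<open>Iteration and coincidence of the curves\<close>

lemma frontier_subset: "frontier S \<subseteq> frontier T"
proof -
  obtain L where L0: "L > 0" and L: "extent_bound L"
    using uniform_bound by blast
  obtain \<rho> where \<rho>: "cone_width \<rho>"
    using uniform_cone by blast
  note \<rho>0 = cone_widthD(1)[OF \<rho>]
  \<comment> \<open>\<open>K\<close> is the error factor of a step, \<open>E\<close> the constant of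
    \<open>ray_pair_bound\<close>, and \<open>c\<close> the least growth of the cotangent per
    step.\<close>
  define K where "K = L / \<rho>"
  define E where "E = 2 * L\<^sup>2 / \<rho>"
  define c where "c = \<bar>X P - X Q\<bar> / L"
  have K: "K > 0" and E: "E > 0" and c: "c > 0"
    using L0 \<rho>0 axis by (auto simp: K_def E_def c_def)
  \<comment> \<open>The left side does not decrease from one pair to the next, and after
    \<open>n\<close> steps the cotangent is at least \<open>w + real n * c\<close>; the a priori
    bound at that pair therefore holds for the initial one.\<close>
  have iter: "\<bar>X A' - X A\<bar> * (1 - K / w) \<le> E / (w + real n * c)"
    if "ray_pair M N A A' w" "K \<le> w" for n M N A A' w
    using that
  proof (induction n arbitrary: M N A A' w)
    case 0
    have "w > 0" using 0 K by simp
    then have "\<bar>X A' - X A\<bar> * (1 - K / w) \<le> \<bar>X A' - X A\<bar> * 1"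
      using K by (intro mult_left_mono) auto
    also have "\<dots> \<le> E / w"
      using ray_pair_bound[OF L \<rho> 0(1)] by (simp add: E_def)
    finally show ?case by simp
  next
    case (Suc n)
    obtain B B' v where B: "ray_pair N M B B' v" "v \<ge> w + c"
      "\<rho> * \<bar>(X A' - X A) - (X B' - X B)\<bar> \<le> L * \<bar>X A' - X A\<bar> * (1 / w - 1 / v)"
      using ray_pair_step[OF L \<rho> Suc.prems(1)] unfolding c_def by blast
    have wv: "w > 0" "w \<le> v" "K \<le> v" using B(2) Suc.prems(2) K c by linarith+
    have "\<bar>(X A' - X A) - (X B' - X B)\<bar> \<le> K * \<bar>X A' - X A\<bar> * (1 / w - 1 / v)"
      using B(3) \<rho>0 by (simp add: K_def field_simps)
    then have "\<bar>X A' - X A\<bar> * (1 - K / w) \<le> \<bar>X B' - X B\<bar> * (1 - K / v)"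
      by (rule potential_mono) (use K wv Suc.prems in auto)
    also have "\<dots> \<le> E / (v + real n * c)"
      by (rule Suc.IH[OF B(1) wv(3)])
    also have "\<dots> \<le> E / (w + real (Suc n) * c)"
      using E c wv B(2) by (intro divide_left_mono mult_pos_pos) (auto simp: algebra_simps intro: add_pos_nonneg)
    finally show ?case .
  qed
  \<comment> \<open>Letting \<open>n\<close> grow in \<open>iter\<close> makes the left side vanish.
    Since \<open>K < w\<close> is strict, the factor \<open>1 - K / w\<close> is positive, so
    \<open>A\<close> and \<open>A'\<close> have equal \<open>X\<close>; on a common ray with
    positive cotangent they coincide.\<close>
  have far: "A \<in> frontier T"
    if MN: "(M, N) \<in> {(P, Q), (Q, P)}" and A: "A \<in> frontier S" and w: "X A - X M = w * (Y A - Y M)"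
      and side: "(X N - X M) * (Y A - Y M) > 0" and Kw: "K < w" for M N A w
  proof -
    have M: "M \<in> {P, Q}" using MN by auto
    obtain r where r: "r > 0" "M + r *\<^sub>R (A - M) \<in> frontier T"
      using ray_meets_T[OF M antipode_S(1)[OF M A]] by blast
    define A' where "A' = M + r *\<^sub>R (A - M)"
    have pair: "ray_pair M N A A' w"
      unfolding ray_pair_def using MN A r w side Kw K by (auto simp: A'_def)
    define g where "g = \<bar>X A' - X A\<bar> * (1 - K / w)"
    have "g \<le> 0"
    proof (rule ccontr)
      assume "\<not> g \<le> 0"
      then have g: "g > 0" by simp
      obtain n where "E / g / c < real n" using reals_Archimedean2 by blast
      then have "E < g * (real n * c)" using g c by (simp add: field_simps)
      also have "\<dots> \<le> g * (w + real n * c)" using g Kw K by simp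
      finally have "E / (w + real n * c) < g"
        using Kw K c by (simp add: divide_less_eq add_pos_nonneg)
      with iter[OF pair, of n] Kw show False by (simp add: g_def)
    qed
    then have "X A' = X A"
      using Kw K by (simp add: g_def mult_le_0_iff)
    moreover have "X A' - X M = r * (X A - X M)" by (simp add: A'_def coords_simps)
    moreover have "X A - X M \<noteq> 0" using w side Kw K by auto
    ultimately have "r = 1" by simp
    then show ?thesis using r by simp
  qed
  \<comment> \<open>Here \<open>w\<close> may have any sign. Chords are followed until the cotangent
    exceeds \<open>K\<close>, where \<open>far\<close> applies; each chord is then retraced, since
    \<open>antipode\<close> is an involution that preserves \<open>frontier T\<close>.\<close>
  have main: "A \<in> frontier T"
    if "(M, N) \<in> {(P, Q), (Q, P)}" "A \<in> frontier S" "X A - X M = w * (Y A - Y M)"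
      "(X N - X M) * (Y A - Y M) > 0" "K < w + real n * c" for n M N A w
    using that
  proof (induction n arbitrary: M N A w)
    case 0
    then show ?case using far by simp
  next
    case (Suc n)
    define B where "B = antipode k M A"
    have M: "M \<in> {P, Q}" and sym: "(N, M) \<in> {(P, Q), (Q, P)}" using Suc.prems(1) by auto
    obtain v where v: "X B - X N = v * (Y B - Y N)" "(X M - X N) * (Y B - Y N) > 0" "v \<ge> w + c"
      unfolding c_def by (rule cot_step[OF _ Suc.prems(1-4) B_def, of L]) (use extent_boundD[OF L] in auto)
    have "B \<in> frontier T"
      by (rule Suc.IH[OF sym _ v(1,2)])
        (use antipode_S(3)[OF M Suc.prems(2)] Suc.prems(5) v(3) in \<open>auto simp: B_def algebra_simps\<close>)
    from antipode_T(3)[OF M this] show ?case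
      by (simp add: B_def antipode_antipode[OF antipode_S(1,2)[OF M Suc.prems(2)]])
  qed
  show ?thesis
  proof
    fix A assume A: "A \<in> frontier S"
    show "A \<in> frontier T"
    proof (cases "Y A = Y P")
      case True
      then show ?thesis using axis_S[OF A] vertices_mem by auto
    next
      case False
      have ex: "\<exists>n. K < w + real n * c" for w
      proof -
        obtain n where "(K - w) / c < real n" using reals_Archimedean2 by blast
        then show ?thesis using c by (auto simp: field_simps)
      qed
      \<comment> \<open>\<open>P\<close> and \<open>Q\<close> have equal height, so exchanging them
        flips the sign: off the axis exactly one order of the centres meets the side
        condition.\<close>
      have "(X Q - X P) * (Y A - Y P) > 0 \<or> (X P - X Q) * (Y A - Y Q) > 0"
        using False axis by (auto simp: zero_less_mult_iff)
      then obtain M N where MN: "(M, N) \<in> {(P, Q), (Q, P)}" "(X N - X M) * (Y A - Y M) > 0"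
        by blast
      define w where "w = (X A - X M) / (Y A - Y M)"
      have "X A - X M = w * (Y A - Y M)" using MN by (auto simp: w_def)
      with ex[of w] main[OF MN(1) A _ MN(2)] show ?thesis by blast
    qed
  qed
qed

end

section \<open>Return to curves in the plane\<close>

text \<open>\<open>X\<close> is the inner product with \<open>e = Q - P\<close>, and
  \<open>f\<close> is \<open>e\<close> turned by a right angle; dividing by
  \<open>e \<bullet> e\<close> normalises \<open>Y f\<close> to \<open>1\<close>. The determinant of
  the resulting linear system is \<open>e \<bullet> e\<close>, hence nonzero.\<close>

lemma planar_coordinates_exist:
  fixes P Q :: plane
  assumes "P \<noteq> Q"
  obtains X Y f where "planar_coordinates X Y f" "Y P = Y Q" "X P \<noteq> X Q"
proof -
  define e where "e = Q - P"
  define X where "X Z = Z \<bullet> e" for Z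
  define f :: plane where "f = vector [- e $ 2, e $ 1]"
  define Y where "Y Z = (Z \<bullet> f) / (e \<bullet> e)" for Z
  have ee: "e \<bullet> e \<noteq> 0" using assms by (simp add: e_def)
  have sq: "e \<bullet> e = e $ 1 * e $ 1 + e $ 2 * e $ 2"
    by (simp add: inner_vec_def sum_2)
  have Xf: "X f = 0" and ef: "e \<bullet> f = 0" and ff: "f \<bullet> f = e \<bullet> e"
    by (simp_all add: X_def f_def inner_vec_def sum_2)
  show ?thesis
  proof (rule that[of X Y f])
    show "planar_coordinates X Y f"
    proof (rule planar_coordinates.intro)
      show "linear X" "linear Y"
        by (simp_all add: linear_iff X_def Y_def inner_add_left add_divide_distrib)
      show "X f = 0" by (rule Xf)
      show "Y f = 1" using ee by (simp add: Y_def ff)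
      fix A B assume "X A = X B" "Y A = Y B"
      then have 1: "(A - B) \<bullet> e = 0" and 2: "(A - B) \<bullet> f = 0"
        using ee by (simp_all add: X_def Y_def inner_diff_left)
      define a where "a = (A - B) $ 1"
      define b where "b = (A - B) $ 2"
      have "a * e $ 1 + b * e $ 2 = 0" "b * e $ 1 - a * e $ 2 = 0"
        using 1 2 by (simp_all add: a_def b_def f_def inner_vec_def sum_2 mult.commute)
      then have "a * (e \<bullet> e) = 0" "b * (e \<bullet> e) = 0"
        unfolding sq by algebra+
      then have "a = 0" "b = 0" using ee by simp_all
      then show "A = B"
        by (simp add: a_def b_def vec_eq_iff forall_2)
    qed
    have "Q = P + e" by (simp add: e_def)
    then show "Y P = Y Q" "X P \<noteq> X Q"
      using ee by (simp_all add: X_def Y_def inner_add_left ef)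
  qed
qed

lemma equichordal_curve_subset:
  fixes V\<^sub>1 P Q V\<^sub>2 :: plane
  assumes dist: "distinct [V\<^sub>1, P, Q, V\<^sub>2]"
    and btw: "between (V\<^sub>1, V\<^sub>2) P" "between (V\<^sub>1, V\<^sub>2) Q"
    and C: "analytic_equichordal_curve C P Q V\<^sub>1 V\<^sub>2"
    and D: "analytic_equichordal_curve D P Q V\<^sub>1 V\<^sub>2"
  shows "C \<subseteq> D"
proof -
  obtain X Y f where "planar_coordinates X Y f" and ax: "Y P = Y Q" "X P \<noteq> X Q"
    using planar_coordinates_exist[of P Q] dist by auto
  then interpret planar_coordinates X Y f by simp
  have curve: "frontier (inside E) = E" "open (inside E)" "convex (inside E)" "bounded (inside E)"
    "{V\<^sub>1, V\<^sub>2} = {A \<in> E. Y A = Y P}" "{P, Q} \<subseteq> inside E"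
    if E: "analytic_equichordal_curve E P Q V\<^sub>1 V\<^sub>2" for E
  proof -
    have j: "jordan_curve E" and c: "convex (inside E)" and PQ: "P \<in> inside E" "Q \<in> inside E"
      and v: "E \<inter> affine hull {P, Q} = {V\<^sub>1, V\<^sub>2}"
      using E by (auto simp: analytic_equichordal_curve_def equichordal_point_def vertices_def)
    show fr: "frontier (inside E) = E"
      using j c PQ by (intro frontier_inside_jordan_curve convex_connected) auto
    show "convex (inside E)" "{P, Q} \<subseteq> inside E" using c PQ by auto
    have "compact E"
      using j compact_simple_path_image unfolding jordan_curve_def by blast
    then show "open (inside E)" "bounded (inside E)"
      by (auto intro: open_inside bounded_inside compact_imp_closed compact_imp_bounded)
    show "{V\<^sub>1, V\<^sub>2} = {A \<in> E. Y A = Y P}"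
      unfolding v[symmetric] using affine_hull_iff[OF ax] by blast
  qed
  \<comment> \<open>The segment between the vertices is a chord through both centres, so it fixes
    the same constant for either centre and either curve.\<close>
  have chord: "norm (A - M) + norm (B - M) = dist V\<^sub>1 V\<^sub>2"
    if E: "analytic_equichordal_curve E P Q V\<^sub>1 V\<^sub>2" and M: "M \<in> {P, Q}"
      and AB: "A \<in> E" "B \<in> E" "M \<in> closed_segment A B" for E M A B
  proof -
    have "equichordal_point E M"
      using E M by (auto simp: analytic_equichordal_curve_def)
    then obtain k where k: "\<And>A B. A \<in> E \<Longrightarrow> B \<in> E \<Longrightarrow> M \<in> closed_segment A B \<Longrightarrow>
        norm (A - M) + norm (B - M) = k"
      by (auto simp: equichordal_point_def)
    have "between (V\<^sub>1, V\<^sub>2) M" using btw M by auto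
    moreover have "V\<^sub>1 \<in> E" "V\<^sub>2 \<in> E" using curve(5)[OF E] by auto
    ultimately have "norm (V\<^sub>1 - M) + norm (V\<^sub>2 - M) = k" "dist V\<^sub>1 V\<^sub>2 = dist V\<^sub>1 M + dist M V\<^sub>2"
      using k by (auto simp: between_mem_segment[symmetric] between)
    then have "k = dist V\<^sub>1 V\<^sub>2" by (simp add: dist_norm norm_minus_commute)
    then show ?thesis using k AB by simp
  qed
  have VY: "Y V\<^sub>1 = Y P" "Y V\<^sub>2 = Y P" using curve(5)[OF C] by auto
  have sep: "(X V\<^sub>1 - X M) * (X V\<^sub>2 - X M) < 0" if M: "M \<in> {P, Q}" for M
  proof -
    have "M \<in> closed_segment V\<^sub>1 V\<^sub>2" using btw M by (auto simp: between_mem_segment)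
    then obtain u where u: "0 \<le> u" "u \<le> 1" "M = (1 - u) *\<^sub>R V\<^sub>1 + u *\<^sub>R V\<^sub>2"
      by (auto simp: in_segment)
    have "M \<noteq> V\<^sub>1" "M \<noteq> V\<^sub>2" using M dist by auto
    with u have u01: "0 < u" "u < 1" by (auto simp: less_le)
    have "X V\<^sub>1 \<noteq> X V\<^sub>2" using coords_eqI[of V\<^sub>1 V\<^sub>2] VY dist by auto
    then have "u * (1 - u) * (X V\<^sub>1 - X V\<^sub>2)\<^sup>2 > 0" using u01 by simp
    also have "u * (1 - u) * (X V\<^sub>1 - X V\<^sub>2)\<^sup>2 = - ((X V\<^sub>1 - X M) * (X V\<^sub>2 - X M))"
      by (simp add: u(3) coords_simps power2_eq_square algebra_simps)
    finally show ?thesis by simp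
  qed
  interpret equichordal_pair X Y f "inside C" "inside D" P Q V\<^sub>1 V\<^sub>2 "dist V\<^sub>1 V\<^sub>2"
  proof
    show "open (inside C)" "convex (inside C)" "bounded (inside C)"
      "open (inside D)" "convex (inside D)" "bounded (inside D)"
      using curve C D by blast+
    show "Y P = Y Q" "X P \<noteq> X Q" by (fact ax)+
    show "M \<in> inside C \<inter> inside D" if "M \<in> {P, Q}" for M
      using curve(6)[OF C] curve(6)[OF D] that by blast
    show "norm (A - M) + norm (B - M) = dist V\<^sub>1 V\<^sub>2"
      if "M \<in> {P, Q}" "A \<in> frontier (inside C)" "B \<in> frontier (inside C)" "M \<in> closed_segment A B" for M A B
      using chord[OF C] that by (simp only: curve(1)[OF C])
    show "norm (A - M) + norm (B - M) = dist V\<^sub>1 V\<^sub>2"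
      if "M \<in> {P, Q}" "A \<in> frontier (inside D)" "B \<in> frontier (inside D)" "M \<in> closed_segment A B" for M A B
      using chord[OF D] that by (simp only: curve(1)[OF D])
    show "{V\<^sub>1, V\<^sub>2} \<subseteq> frontier (inside C) \<inter> frontier (inside D)"
      using curve(1,5)[OF C] curve(1,5)[OF D] by auto
    show "Y V\<^sub>1 = Y P" "Y V\<^sub>2 = Y P" by (fact VY)+
    show "(X V\<^sub>1 - X M) * (X V\<^sub>2 - X M) < 0" if "M \<in> {P, Q}" for M
      by (rule sep[OF that])
    show "A \<in> {V\<^sub>1, V\<^sub>2}" if "A \<in> frontier (inside C)" "Y A = Y P" for A
      using that unfolding curve(1)[OF C] curve(5)[OF C] by blast
  qed
  show ?thesis
    using frontier_subset curve(1)[OF C] curve(1)[OF D] by simp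
qed

theorem theorem14:
  fixes V\<^sub>1 P Q V\<^sub>2 :: plane
  assumes "distinct [V\<^sub>1, P, Q, V\<^sub>2]"
    and "collinear {V\<^sub>1, P, Q, V\<^sub>2}"
    and "between (V\<^sub>1, V\<^sub>2) P"
    and "between (V\<^sub>1, V\<^sub>2) Q"
    and "\<exists>C. analytic_equichordal_curve C P Q V\<^sub>1 V\<^sub>2"
  shows "\<exists>!C. analytic_equichordal_curve C P Q V\<^sub>1 V\<^sub>2"
proof (rule ex_ex1I)
  show "\<exists>C. analytic_equichordal_curve C P Q V\<^sub>1 V\<^sub>2" by (fact assms(5))
  fix C D
  assume C: "analytic_equichordal_curve C P Q V\<^sub>1 V\<^sub>2" and D: "analytic_equichordal_curve D P Q V\<^sub>1 V\<^sub>2"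
  \<comment> \<open>The inclusion is available in both directions, since the hypotheses on the two
    curves are the same.\<close>
  note subset = equichordal_curve_subset[OF assms(1,3,4)]
  show "C = D" by (rule subset_antisym[OF subset[OF C D] subset[OF D C]])
qed

end
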